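(* For every integer $n \geq 4$ there exists an algorithm solving the priority evacuation problem $PE_n$ (one queen and $n$ servants) whose evacuation time is at most $2 + 4(\sqrt{2}-1)\frac{\pi}{n}$.
   Context: Priority evacuation problem $PE_n$: $n+1$ mobile robots, one distinguished robot called the queen and $n$ robots called servants, all start at time $0$ at the center $O=(0,0)$ of the unit disk. Each robot moves with speed at most $1$. An exit is located at an unknown point of the unit circle $\mathcal{U}$ (the boundary of the disk); a robot discovers the exit when it walks over its location, and immediately and instantaneously broadcasts its position to all robots (wireless communication). An algorithm specifies the trajectories of all robots as functions of time for as long as the exit has not been found; once the exit is found, the queen moves to it. An algorithm solves $PE_n$ if, in finite time, every point of $\mathcal{U}$ is visited by at least one robot. The evacuation time of an algorithm is the worst case, over all possible exit positions on $\mathcal{U}$, of the time at which the queen reaches the exit. The queen may or may not participate in the search. *)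

theory Defs
  imports "HOL-Analysis.Analysis" "HOL-Library.Extended_Real"
begin

text \<open>
  The plane is identified with \<^typ>\<open>complex\<close>, so the centre of the disk is \<open>0\<close> and the unit circle
  is \<open>sphere 0 1\<close>. An algorithm assigns to every robot its trajectory, as a function of time
  \<open>t \<ge> 0\<close>, that it follows as long as the exit has not been found.
\<close>

datatype robot = Queen | Servant nat

definition robots :: "nat \<Rightarrow> robot set" where
  "robots n = insert Queen (Servant ` {1..n})"

type_synonym algorithm = "robot \<Rightarrow> real \<Rightarrow> complex"

text \<open>Speed at most \<open>1\<close> is rendered as \<open>1\<close>-Lipschitz continuity in time.\<close>

definition valid_algorithm :: "nat \<Rightarrow> algorithm \<Rightarrow> bool" where
  "valid_algorithm n A \<longleftrightarrow> (\<forall>r\<in>robots n. A r 0 = 0 \<and> 1-lipschitz_on {0..} (A r))"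

definition solves_PE :: "nat \<Rightarrow> algorithm \<Rightarrow> bool" where
  "solves_PE n A \<longleftrightarrow> valid_algorithm n A \<and>
     (\<exists>T\<ge>0. \<forall>x\<in>sphere 0 1. \<exists>r\<in>robots n. \<exists>t\<in>{0..T}. A r t = x)"

text \<open>
  The infimum is only meaningful (and is then attained, trajectories being continuous) if \<open>x\<close> is
  visited by some robot, which \<open>solves_PE\<close> guarantees for all points of the circle.
\<close>

definition discovery_time :: "nat \<Rightarrow> algorithm \<Rightarrow> complex \<Rightarrow> real" where
  "discovery_time n A x = Inf {t. 0 \<le> t \<and> (\<exists>r\<in>robots n. A r t = x)}"

text \<open>
  At the discovery time the queen leaves her trajectory and moves to the exit along a straight line
  at unit speed.
\<close>

definition queen_arrival_time :: "nat \<Rightarrow> algorithm \<Rightarrow> complex \<Rightarrow> real" where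
  "queen_arrival_time n A x =
     discovery_time n A x + dist (A Queen (discovery_time n A x)) x"

text \<open>The supremum is taken in \<^typ>\<open>ereal\<close>, so that it is the true one without a boundedness proof.\<close>

definition evacuation_time :: "nat \<Rightarrow> algorithm \<Rightarrow> ereal" where
  "evacuation_time n A = (SUP x\<in>sphere 0 1. ereal (queen_arrival_time n A x))"

end

theory Submission
  imports Defs
begin

text \<open>
  Let \<open>\<kappa> = 1 + sqrt 2\<close> and let \<open>(\<kappa> + 1) * e\<close> be the excess over \<open>2\<close> in the bound. The queen waits
  at the centre until time \<open>1 + \<kappa> * e\<close> and then walks along the positive real axis. She reaches
  \<open>cis s\<close> in time iff it is discovered by time \<open>1 + \<kappa> * e + grace e s\<close>: this is the time at
  which she is at distance \<open>q\<close> from the centre with \<open>q + dist q (cis s) = 1 + e\<close>.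

  To first order in \<open>e\<close>, the deadline is \<open>e * (\<kappa> + 1 / (1 - cos s))\<close>, so one servant can search about
  that length of circle near \<open>cis s\<close>. The integral of the reciprocal over the circle is exactly
  \<open>n\<close>; \<open>sweep\<close> is \<open>\<kappa> * e\<close> times its antiderivative. The circle is cut into \<open>n\<close> arcs of equal
  \<open>sweep\<close>, and each servant searches its arc from the end nearer to \<open>-1\<close> (early deadlines) to the
  end nearer to \<open>1\<close> (late deadlines). The length searched by a servant is then compared with the
  deadline where it is, rather than with the average over the arc; this gain outweighs the loss from
  the first-order approximation of \<open>grace\<close>.
\<close>

subsection \<open>Search capacity along the circle\<close>

text \<open>If the queen waits \<open>k * e\<close> after time \<open>1\<close>, the reciprocals of
  the first-order deadlines integrate to
  \<open>(2 * pi / k) * (1 - 1 / sqrt (1 + 2 * k)) / e\<close>. Hence the excess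
  \<open>(k + 1) * e\<close> is proportional to
  \<open>(1 + 1 / k) * (1 - 1 / sqrt (1 + 2 * k))\<close>, which is least at
  \<open>k = 1 + sqrt 2\<close>; there also \<open>sqrt (1 + 2 * k) = k\<close>.\<close>

definition kappa :: real where "kappa = 1 + sqrt 2"

lemma kappa_sq: "kappa * kappa = 2 * kappa + 1"
  by (simp add: kappa_def algebra_simps)

lemma kappa_bounds: "24 / 10 < kappa" "kappa < 242 / 100"
proof -
  have "sqrt (1.4\<^sup>2) < sqrt 2" "sqrt 2 < sqrt (1.42\<^sup>2)"
    by (intro real_sqrt_less_mono; simp add: power2_eq_square)+
  then show "24 / 10 < kappa" "kappa < 242 / 100"
    by (simp_all add: kappa_def)
qed

text \<open>
  Equal to \<open>s - (2 / kappa) * arctan (kappa * tan (s / 2))\<close> for \<open>\<bar>s\<bar> < pi\<close>, in a form without the pole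
  of \<open>tan\<close> at \<open>pi / 2\<close>.
\<close>

definition sweep :: "real \<Rightarrow> real" where
  "sweep s = (3 - kappa) * s - 2 * (kappa - 2) * arctan (sin s / (kappa - cos s))"

text \<open>Squaring \<open>dist q (cis s) = 1 + e - q\<close> cancels the squares of
  \<open>q\<close>; this solves the linear equation that remains.\<close>

definition grace :: "real \<Rightarrow> real \<Rightarrow> real" where
  "grace e s = (e + e\<^sup>2 / 2) / (1 + e - cos s)"

text \<open>The quotient of \<open>kappa * e\<close> by the first-order deadline, with fractions
  cleared so that \<open>cos s = 1\<close> is covered.\<close>

definition sweep' :: "real \<Rightarrow> real" where
  "sweep' s = kappa * (1 - cos s) / (1 + kappa * (1 - cos s))"

lemma one_plus_kappa_pos: "0 < 1 + kappa * (1 - cos s)"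
proof -
  have "0 \<le> kappa * (1 - cos s)" using kappa_bounds by simp
  then show ?thesis by linarith
qed

lemma DERIV_sweep: "(sweep has_real_derivative sweep' s) (at s)"
proof -
  define z where "z = 1 - cos s"
  have M: "kappa - cos s > 0" using cos_le_one[of s] kappa_bounds by linarith
  have P: "1 + kappa * z > 0" unfolding z_def by (rule one_plus_kappa_pos)
  have c: "cos s = 1 - z" by (simp add: z_def)
  have s2: "sin s * sin s = 1 - (1 - z) * (1 - z)"
    using sin_cos_squared_add[of s] by (simp add: c power2_eq_square)
  have "((\<lambda>s. arctan (sin s / (kappa - cos s))) has_real_derivative
      inverse (1 + (sin s / (kappa - cos s))\<^sup>2) *
        ((cos s * (kappa - cos s) - sin s * sin s) / ((kappa - cos s) * (kappa - cos s)))) (at s)"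
    using M by (auto intro!: derivative_eq_intros)
  moreover have "inverse (1 + (sin s / (kappa - cos s))\<^sup>2) *
        ((cos s * (kappa - cos s) - sin s * sin s) / ((kappa - cos s) * (kappa - cos s)))
      = (kappa * (1 - z) - 1) / (2 * (1 + kappa * z))"
  proof -
    have "1 + (sin s / (kappa - cos s))\<^sup>2
        = ((kappa - cos s) * (kappa - cos s) + sin s * sin s) / ((kappa - cos s) * (kappa - cos s))"
      using M by (simp add: add_divide_distrib power2_eq_square)
    \<comment> \<open>Since \<open>kappa * kappa + 1 = 2 * (kappa + 1)\<close>, the sum is a
      multiple of the denominator of \<open>sweep'\<close>.\<close>
    also have "(kappa - cos s) * (kappa - cos s) + sin s * sin s = 2 * (1 + kappa * z)"
      using kappa_sq unfolding s2 c by (simp add: algebra_simps)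
    finally have 1: "1 + (sin s / (kappa - cos s))\<^sup>2
        = 2 * (1 + kappa * z) / ((kappa - cos s) * (kappa - cos s))" .
    have 2: "cos s * (kappa - cos s) - sin s * sin s = kappa * (1 - z) - 1"
      unfolding s2 c by (simp add: algebra_simps)
    have "inverse (p / q) * (m / q) = m / p" if "q \<noteq> 0" for p q m :: real
      using that by simp
    then show ?thesis unfolding 1 2 using M by simp
  qed
  ultimately have "((\<lambda>s. arctan (sin s / (kappa - cos s))) has_real_derivative
      (kappa * (1 - z) - 1) / (2 * (1 + kappa * z))) (at s)" by simp
  from DERIV_diff[OF DERIV_cmult[OF DERIV_ident, of "3 - kappa"]
      DERIV_cmult[OF this, of "2 * (kappa - 2)"]]
  have D: "(sweep has_real_derivative
      (3 - kappa) - 2 * (kappa - 2) * ((kappa * (1 - z) - 1) / (2 * (1 + kappa * z)))) (at s)"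
    unfolding sweep_def[abs_def] by simp
  \<comment> \<open>As \<open>kappa * (kappa - 2) = 1\<close>, both sides equal
    \<open>3 - kappa - z\<close>.\<close>
  have "(kappa - 2) * (kappa * (1 - z) - 1) = (3 - kappa) * (1 + kappa * z) - kappa * z"
    using kappa_sq by algebra
  then have "sweep' s
      = ((3 - kappa) * (1 + kappa * z) - (kappa - 2) * (kappa * (1 - z) - 1)) / (1 + kappa * z)"
    by (simp only: sweep'_def z_def[symmetric]) simp
  also have "\<dots> = (3 - kappa) - 2 * (kappa - 2) * ((kappa * (1 - z) - 1) / (2 * (1 + kappa * z)))"
  proof -
    have "(k * P - c * N) / P = k - 2 * c * (N / (2 * P))" if "P > 0" for k c N P :: real
      using that by (simp add: diff_divide_distrib)
    then show ?thesis using P by blast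
  qed
  finally show ?thesis using D by simp
qed

lemma sweep_0 [simp]: "sweep 0 = 0" and sweep_pi: "sweep pi = (3 - kappa) * pi"
  by (simp_all add: sweep_def)

lemma sweep_reflect: "sweep (2 * pi - s) = 2 * sweep pi - sweep s"
  by (simp add: sweep_def sin_diff cos_diff arctan_minus algebra_simps)

lemma sweep'_nonneg: "0 \<le> sweep' s"
  using one_plus_kappa_pos[of s] kappa_bounds by (simp add: sweep'_def)

lemma sweep_strict_mono:
  assumes "0 \<le> s" "s < t" "t \<le> 2 * pi"
  shows "sweep s < sweep t"
proof (rule DERIV_pos_imp_increasing_open[OF assms(2)])
  fix x assume x: "s < x" "x < t"
  have "cos x \<noteq> 1"
  proof
    assume "cos x = 1"
    then obtain n :: int where n: "x = n * 2 * pi" using cos_one_2pi_int by auto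
    have "0 < x" "x < 2 * pi" using x assms by linarith+
    then have "0 < real_of_int n" "real_of_int n < 1"
      using n by (simp_all add: zero_less_mult_iff)
    then show False by simp
  qed
  then have "cos x < 1" using cos_le_one[of x] by linarith
  then have "sweep' x > 0"
    using one_plus_kappa_pos[of x] kappa_bounds by (simp add: sweep'_def)
  then show "\<exists>y. (sweep has_real_derivative y) (at x) \<and> 0 < y" using DERIV_sweep by blast
next
  show "continuous_on {s..t} sweep"
    by (intro continuous_at_imp_continuous_on ballI DERIV_isCont[OF DERIV_sweep])
qed

lemma sweep_le_iff:
  assumes "0 \<le> s" "s \<le> 2 * pi" "0 \<le> t" "t \<le> 2 * pi"
  shows "sweep s \<le> sweep t \<longleftrightarrow> s \<le> t"
  using sweep_strict_mono[of s t] sweep_strict_mono[of t s] assms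
  by (cases s t rule: linorder_cases) auto

lemma sweep_surj:
  assumes "0 \<le> y" "y \<le> 2 * sweep pi"
  obtains s where "0 \<le> s" "s \<le> 2 * pi" "sweep s = y"
proof -
  have "\<exists>s. 0 \<le> s \<and> s \<le> 2 * pi \<and> sweep s = y"
    using assms sweep_reflect[of 0] DERIV_isCont[OF DERIV_sweep]
    by (intro IVT) auto
  then show ?thesis using that by blast
qed

text \<open>Beyond the first arc \<open>e\<close> is of third order in \<open>h\<close>, which
  controls the error of the first-order deadline. With \<open>a = tan (s / 2)\<close>, the cubic
  term times \<open>kappa\<close> has derivative
  \<open>kappa * (2 * a\<^sup>2 * (1 + a\<^sup>2))\<close>, and \<open>sweep'\<close> is at most
  \<open>kappa * (1 - cos s)\<close>.\<close>

lemma le_tan_cubed_of_le_sweep: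
  assumes "0 \<le> h" "h < pi" "kappa * e \<le> sweep h"
  shows "e \<le> 4 / 3 * tan (h / 2) ^ 3"
proof -
  define f where "f = (\<lambda>s. kappa * (4 / 3 * tan (s / 2) ^ 3) - sweep s)"
  have "f 0 \<le> f h"
  proof (rule DERIV_nonneg_imp_nondecreasing[OF assms(1)])
    fix s assume s: "0 \<le> s" "s \<le> h"
    define a where "a = tan (s / 2)"
    have c: "cos (s / 2) > 0" using s assms by (intro cos_gt_zero_pi) auto
    have sec: "inverse ((cos (s / 2))\<^sup>2) = 1 + a\<^sup>2"
      using tan_sec[of "s / 2"] c by (simp add: a_def power_inverse)
    have "((\<lambda>s. tan (s / 2)) has_real_derivative (1 + a\<^sup>2) * (1 / 2)) (at s)"
      unfolding sec[symmetric]
      by (rule DERIV_chain2[where f = tan]) (use c in \<open>auto intro!: derivative_eq_intros\<close>)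
    from DERIV_power[OF this, of 3]
    have "((\<lambda>s. tan (s / 2) ^ 3) has_real_derivative 3 / 2 * a\<^sup>2 * (1 + a\<^sup>2)) (at s)"
      by (simp add: a_def algebra_simps add_divide_distrib)
    from DERIV_diff[OF DERIV_cmult[OF DERIV_cmult[OF this, of "4 / 3"], of kappa] DERIV_sweep]
    have D: "(f has_real_derivative kappa * (2 * a\<^sup>2 * (1 + a\<^sup>2)) - sweep' s) (at s)"
      unfolding f_def by (simp add: algebra_simps add_divide_distrib)
    have z: "1 - cos s = 2 * (sin (s / 2))\<^sup>2"
      using cos_double_sin[of "s / 2"] by simp
    have "sweep' s \<le> kappa * (1 - cos s)"
      unfolding sweep'_def using kappa_bounds one_plus_kappa_pos[of s]
      by (simp add: divide_le_eq mult_le_cancel_left1)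
    also have "\<dots> \<le> kappa * (2 * a\<^sup>2 * (1 + a\<^sup>2))"
    proof (rule mult_left_mono)
      have "(sin (s / 2))\<^sup>2 = a\<^sup>2 * (cos (s / 2))\<^sup>2"
        using c by (simp add: a_def tan_def power_divide)
      also have "\<dots> \<le> a\<^sup>2 * (1 + a\<^sup>2)"
        by (rule mult_left_mono) (use cos_squared_eq[of "s/2"] in \<open>simp_all add: add_increasing2\<close>)
      finally show "1 - cos s \<le> 2 * a\<^sup>2 * (1 + a\<^sup>2)" using z by simp
    qed (use kappa_bounds in simp)
    finally show "\<exists>y. (f has_real_derivative y) (at s) \<and> 0 \<le> y" using D by force
  qed
  then have "kappa * e \<le> kappa * (4 / 3 * tan (h / 2) ^ 3)"
    using assms(3) by (simp add: f_def)
  then show ?thesis using kappa_bounds by simp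
qed

subsection \<open>Arcs away from the direction of the queen\<close>

lemma one_minus_cos_half: "1 - cos s = 2 * (sin (s / 2))\<^sup>2" for s :: real
  using cos_double_sin[of "s / 2"] by simp

lemma le_one_minus_cos_plus_sin:
  fixes x :: real
  assumes "0 \<le> x" "x \<le> pi / 2"
  shows "x \<le> 1 - cos x + sin x"
proof -
  define f where "f = (\<lambda>x::real. 1 - cos x + sin x - x)"
  have "f 0 \<le> f x"
  proof (rule DERIV_nonneg_imp_nondecreasing[OF assms(1)])
    fix t assume t: "0 \<le> t" "t \<le> x"
    have D: "(f has_real_derivative sin t + cos t - 1) (at t)"
      unfolding f_def by (auto intro!: derivative_eq_intros)
    have "sin t \<ge> 0" "cos t \<ge> 0"
      using t assms by (auto intro!: sin_ge_zero cos_ge_zero)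
    then have "(sin t)\<^sup>2 \<le> sin t" "(cos t)\<^sup>2 \<le> cos t"
      by (simp_all add: power2_eq_square mult_left_le)
    then have "0 \<le> sin t + cos t - 1" using sin_cos_squared_add[of t] by linarith
    with D show "\<exists>y. (f has_real_derivative y) (at t) \<and> 0 \<le> y" by blast
  qed
  then show ?thesis by (simp add: f_def)
qed

text \<open>Made for \<open>min_tan_times_deadline_ge\<close>: \<open>26 / 15\<close> is
  \<open>24 / 10 - (8 / 3) / 4\<close>, where \<open>24 / 10\<close> bounds \<open>kappa\<close>
  from below and \<open>8 / 3 * a\<close> bounds \<open>e / (sin (h / 2))\<^sup>2\<close> from
  above.\<close>

lemma cubic_bound:
  fixes a :: real
  assumes "0 < a"
  shows "1 - 26 / 15 * a \<le> 1 / (a * (2 + 8 / 3 * a))"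
proof -
  \<comment> \<open>The cube lies above its tangent at \<open>9 / 20\<close>; with the tangent in
    its place, the polynomial below has only positive coefficients.\<close>
  have "0 \<le> (a - 9 / 20)\<^sup>2 * (a + 9 / 10)" using assms by simp
  also have "(a - 9 / 20)\<^sup>2 * (a + 9 / 10) = a ^ 3 - 243 / 400 * a + 729 / 4000"
    by (simp add: power2_eq_square power3_eq_cube field_simps)
  finally have "a ^ 3 \<ge> 243 / 400 * a - 729 / 4000" by simp
  then have "0 \<le> 1 - 2 * a + 4 / 5 * a\<^sup>2 + 208 / 45 * a ^ 3"
    using assms zero_le_power2[of a] by linarith
  then have "(1 - 26 / 15 * a) * (a * (2 + 8 / 3 * a)) \<le> 1"
    by (simp add: power2_eq_square power3_eq_cube algebra_simps)
  then show ?thesis using assms by (simp add: le_divide_eq)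
qed

lemma grace_nonneg: "0 \<le> e \<Longrightarrow> 0 \<le> grace e s"
  unfolding grace_def using cos_le_one[of s]
  by (intro divide_nonneg_nonneg) (simp, linarith)

text \<open>Supplies \<open>d \<le> m * x\<close> in \<open>grace_derivative_bound\<close>. If
  \<open>tan (h / 2) \<ge> 1\<close>, the left side is at most \<open>2 * e\<close> and the waiting
  time \<open>kappa * e\<close> suffices. Otherwise the cubic bound on \<open>e\<close> gives
  \<open>e / S\<^sup>2 \<le> 8 / 3 * a\<close>, and up to the factor \<open>e\<close> the claim
  reduces to \<open>cubic_bound\<close>.\<close>

lemma min_tan_times_deadline_ge:
  fixes h e :: real
  assumes h: "0 < h" "h < pi" and e: "0 \<le> e" "e \<le> 1" "e \<le> 4 / 3 * tan (h / 2) ^ 3"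
  shows "e + e\<^sup>2 / (4 * (sin (h / 2))\<^sup>2) \<le> min (tan (h / 2)) 1 * (kappa * e + grace e h)"
proof -
  define S where "S = sin (h / 2)"
  define C where "C = cos (h / 2)"
  define a where "a = tan (h / 2)"
  have S: "S > 0" unfolding S_def using h by (intro sin_gt_zero) auto
  have C: "C > 0" unfolding C_def using h by (intro cos_gt_zero_pi) auto
  have SC: "S\<^sup>2 + C\<^sup>2 = 1" by (simp add: S_def C_def)
  have a: "a = S / C" "a > 0" using S C by (simp_all add: a_def S_def C_def tan_def)
  show ?thesis
  proof (cases "a \<ge> 1")
    case True
    then have "C \<le> S" using a C by (simp add: le_divide_eq)
    then have "C\<^sup>2 \<le> S\<^sup>2" using C by (simp add: power_mono)
    then have "1 / 2 \<le> S\<^sup>2" using SC by linarith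
    then have "e\<^sup>2 / (4 * S\<^sup>2) \<le> e\<^sup>2 / 2" by (intro divide_left_mono) auto
    also have "\<dots> \<le> e" using mult_left_le[OF e(2,1)] e(1) by (simp add: power2_eq_square)
    finally have "e + e\<^sup>2 / (4 * S\<^sup>2) \<le> 2 * e" by simp
    also have "\<dots> \<le> kappa * e + grace e h"
    proof -
      have "2 * e \<le> kappa * e" by (intro mult_right_mono) (use kappa_bounds e in auto)
      then show ?thesis using grace_nonneg[of e h] e by linarith
    qed
    finally show ?thesis using True by (simp add: a_def[symmetric] S_def[symmetric] min_def)
  next
    case False
    have S2: "S\<^sup>2 * (1 + a\<^sup>2) = a\<^sup>2"
    proof -
      have "1 + a\<^sup>2 = 1 / C\<^sup>2" using SC C by (simp add: a(1) field_simps)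
      then show ?thesis by (simp add: a(1) power_divide)
    qed
    have eS: "e / S\<^sup>2 \<le> 8 / 3 * a"
    proof -
      have "e \<le> 4 / 3 * a * a\<^sup>2" using e(3) by (simp add: a_def power3_eq_cube power2_eq_square)
      also have "\<dots> = 4 / 3 * a * (1 + a\<^sup>2) * S\<^sup>2" by (subst S2[symmetric]) simp
      also have "\<dots> \<le> 4 / 3 * a * 2 * S\<^sup>2"
        using a False by (intro mult_right_mono mult_left_mono) (auto simp: power_le_one)
      finally show ?thesis using S by (simp add: divide_le_eq algebra_simps)
    qed
    have den: "1 + e - cos h = 2 * S\<^sup>2 + e" using one_minus_cos_half[of h] by (simp add: S_def)
    have "2 * S\<^sup>2 + e = S\<^sup>2 * (2 + e / S\<^sup>2)" using S by (simp add: field_simps)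
    also have "\<dots> \<le> a\<^sup>2 * (2 + 8 / 3 * a)"
    proof (rule mult_mono)
      have "S\<^sup>2 * 1 \<le> S\<^sup>2 * (1 + a\<^sup>2)" by (rule mult_left_mono) auto
      then show "S\<^sup>2 \<le> a\<^sup>2" using S2 by simp
    qed (use eS a e in auto)
    finally have den_le: "2 * S\<^sup>2 + e \<le> a\<^sup>2 * (2 + 8 / 3 * a)" .
    have "1 + e / S\<^sup>2 / 4 \<le> 24 / 10 * a + (1 - 26 / 15 * a)"
    proof -
      have "1 + P / 4 \<le> 24 / 10 * a + (1 - 26 / 15 * a)" if "P \<le> 8 / 3 * a" for P :: real
        using that by simp
      then show ?thesis using eS .
    qed
    also have "\<dots> \<le> kappa * a + 1 / (a * (2 + 8 / 3 * a))"
      using cubic_bound[OF a(2)] kappa_bounds a(2) by (intro add_mono mult_right_mono) auto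
    also have "1 / (a * (2 + 8 / 3 * a)) = a / (a\<^sup>2 * (2 + 8 / 3 * a))"
      using a by (simp add: power2_eq_square)
    also have "\<dots> \<le> a / (2 * S\<^sup>2 + e)"
      using den_le a S e by (intro divide_left_mono mult_pos_pos) (auto intro: add_pos_nonneg)
    finally have "e * (1 + e / S\<^sup>2 / 4) \<le> e * (kappa * a + a / (2 * S\<^sup>2 + e))"
      using e(1) by (intro mult_left_mono) auto
    also have "\<dots> = a * (kappa * e + e / (2 * S\<^sup>2 + e))" by (simp add: algebra_simps)
    also have "\<dots> \<le> a * (kappa * e + grace e h)"
      unfolding grace_def den using a e
      by (intro mult_left_mono add_left_mono divide_right_mono) auto
    finally show ?thesis using False S
      by (simp add: a_def[symmetric] S_def[symmetric] min_def power2_eq_square algebra_simps)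
  qed
qed

text \<open>Says that \<open>1 - cos\<close> of the angle reached, times the derivative of
  \<open>grace\<close> in \<open>e\<close>, is at least \<open>1\<close>. In half angles, with
  \<open>cos (h / 2 + x) = C * f\<close>, this becomes
  \<open>f\<^sup>2 * (1 + 2 * d) \<le> 1\<close>, which follows from
  \<open>0 \<le> f \<le> 1 - d\<close>.\<close>

lemma grace_derivative_bound:
  fixes h e :: real
  assumes h: "0 < h" "h < pi" and e: "0 \<le> e" "e \<le> 1" "e \<le> 4 / 3 * tan (h / 2) ^ 3"
    and le: "h + (kappa * e + grace e h) \<le> pi"
  defines "y \<equiv> 1 - cos h"
  shows "(y + e)\<^sup>2 \<le> (1 - cos (h + (kappa * e + grace e h))) * (y + y * e + e\<^sup>2 / 2)"
proof -
  define S where "S = sin (h / 2)"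
  define C where "C = cos (h / 2)"
  define a where "a = tan (h / 2)"
  define m where "m = min a 1"
  define x where "x = (kappa * e + grace e h) / 2"
  define f where "f = cos x - a * sin x"
  define d where "d = (e + e\<^sup>2 / (4 * S\<^sup>2)) / 2"
  have S: "S > 0" unfolding S_def using h by (intro sin_gt_zero) auto
  have C: "C > 0" unfolding C_def using h by (intro cos_gt_zero_pi) auto
  have SC: "C\<^sup>2 = 1 - S\<^sup>2" by (simp add: S_def C_def cos_squared_eq)
  have a: "a = S / C" "a > 0" using S C by (simp_all add: a_def S_def C_def tan_def)
  have x0: "0 \<le> x" unfolding x_def using grace_nonneg[of e h] kappa_bounds e by simp
  have x1: "h / 2 + x \<le> pi / 2" using divide_right_mono[OF le, of 2] by (simp add: x_def add_divide_distrib)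
  have sx: "0 \<le> sin x" using x0 x1 h by (intro sin_ge_zero) auto
  have cx: "cos (h / 2 + x) = C * f"
    using C unfolding f_def by (simp add: cos_add a(1) C_def[symmetric] S_def[symmetric] algebra_simps)
  have "0 \<le> cos (h / 2 + x)" using x0 x1 h by (intro cos_ge_zero) auto
  then have f0: "0 \<le> f" using cx C by (simp add: zero_le_mult_iff)
  have "d \<le> m * x"
    using min_tan_times_deadline_ge[OF h e] by (simp add: d_def m_def a_def x_def S_def)
  also have "\<dots> \<le> m * (1 - cos x + sin x)"
    using le_one_minus_cos_plus_sin[of x] x0 x1 h a by (intro mult_left_mono) (auto simp: m_def)
  \<comment> \<open>Here the minimum pays: \<open>m\<close> is bounded by \<open>1\<close> in one
    term and by \<open>a\<close> in the other.\<close>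
  also have "\<dots> \<le> 1 * (1 - cos x) + a * sin x"
    unfolding distrib_left using sx by (intro add_mono mult_right_mono) (auto simp: m_def)
  finally have fd: "f \<le> 1 - d" by (simp add: f_def)
  have d0: "0 \<le> d" using e by (simp add: d_def)
  have "f\<^sup>2 * (1 + 2 * d) \<le> (1 - d)\<^sup>2 * (1 + 2 * d)"
    using f0 fd d0 by (intro mult_right_mono power_mono) auto
  also have "\<dots> = 1 - d\<^sup>2 * (3 - 2 * d)"
    by (simp add: power2_eq_square algebra_simps)
  also have "\<dots> \<le> 1" using f0 fd by simp
  finally have key: "f\<^sup>2 * (1 + 2 * d) \<le> 1" .
  have y: "y = 2 * S\<^sup>2" unfolding y_def S_def by (rule one_minus_cos_half)
  have Sd: "4 * S\<^sup>2 * (2 * d) = 4 * S\<^sup>2 * e + e\<^sup>2" using S by (simp add: d_def field_simps)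
  have "(y + e)\<^sup>2 = 4 * S\<^sup>2 * (1 + 2 * d) - 4 * S\<^sup>2 * C\<^sup>2"
    using Sd unfolding y SC by (simp add: power2_eq_square algebra_simps)
  also have "\<dots> \<le> 4 * S\<^sup>2 * (1 + 2 * d) - 4 * S\<^sup>2 * C\<^sup>2 * (f\<^sup>2 * (1 + 2 * d))"
    using key by (simp add: mult_left_le)
  also have "\<dots> = (2 - 2 * (C * f)\<^sup>2) * (y + y * e + e\<^sup>2 / 2)"
  proof -
    have "y + y * e + e\<^sup>2 / 2 = 2 * S\<^sup>2 * (1 + 2 * d)"
      using Sd unfolding y by (simp add: algebra_simps)
    then show ?thesis by (simp add: power_mult_distrib algebra_simps)
  qed
  also have "2 - 2 * (C * f)\<^sup>2 = 1 - cos (h + (kappa * e + grace e h))"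
  proof -
    have "2 * (h / 2 + x) = h + (kappa * e + grace e h)" by (simp add: x_def)
    then show ?thesis using cos_double_cos[of "h / 2 + x"] by (simp add: cx)
  qed
  finally show ?thesis .
qed

lemma DERIV_grace:
  assumes "0 \<le> e" "cos h < 1"
  shows "((\<lambda>e. grace e h) has_real_derivative
    ((1 - cos h) + (1 - cos h) * e + e\<^sup>2 / 2) / ((1 - cos h) + e)\<^sup>2) (at e)"
proof -
  have "1 + e - cos h \<noteq> 0" using assms by simp
  then have "((\<lambda>e. grace e h) has_real_derivative
      ((1 + e) * (1 + e - cos h) - (e + e\<^sup>2 / 2)) / ((1 + e - cos h) * (1 + e - cos h))) (at e)"
    unfolding grace_def by (auto intro!: derivative_eq_intros)
  moreover have "(1 + e) * (1 + e - cos h) - (e + e\<^sup>2 / 2)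
      = (1 - cos h) + (1 - cos h) * e + e\<^sup>2 / 2"
    by (simp add: power2_eq_square algebra_simps)
  moreover have "(1 + e - cos h) * (1 + e - cos h) = ((1 - cos h) + e)\<^sup>2"
    by (simp add: power2_eq_square algebra_simps)
  ultimately show ?thesis by simp
qed

text \<open>The length allowed by the deadline at \<open>h\<close> carries at least the
  \<open>sweep\<close> of one arc. The hypotheses on \<open>e\<close> pass to all smaller values, so
  \<open>e\<close> can be varied from \<open>0\<close>.\<close>

lemma sweep_grace:
  fixes h e :: real
  assumes h: "0 < h" "h < pi" and e: "0 \<le> e" "e \<le> 1" "kappa * e \<le> sweep h"
    and le: "h + (kappa * e + grace e h) \<le> pi"
  shows "sweep h + kappa * e \<le> sweep (h + (kappa * e + grace e h))"
proof -
  define y where "y = 1 - cos h"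
  have ch: "cos h < 1" using cos_monotone_0_pi[of 0 h] h by simp
  then have y: "0 < y" by (simp add: y_def)
  define \<delta> where "\<delta> = (\<lambda>t. kappa * t + grace t h)"
  define \<rho> where "\<rho> = (\<lambda>t. (y + y * t + t\<^sup>2 / 2) / (y + t)\<^sup>2)"
  have D\<delta>: "(\<delta> has_real_derivative kappa + \<rho> t) (at t)" if "0 \<le> t" for t
    unfolding \<delta>_def \<rho>_def y_def
    by (auto intro!: derivative_eq_intros DERIV_grace[OF that ch])
  have \<rho>0: "0 \<le> \<rho> t" if "0 \<le> t" for t using that y by (simp add: \<rho>_def)
  have \<delta>_mono: "\<delta> t \<le> \<delta> e" if "0 \<le> t" "t \<le> e" for t
  proof (rule DERIV_nonneg_imp_nondecreasing[OF that(2)])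
    fix s assume "t \<le> s" "s \<le> e"
    then have "0 \<le> s" using that by simp
    then show "\<exists>y. (\<delta> has_real_derivative y) (at s) \<and> 0 \<le> y"
      using D\<delta>[of s] \<rho>0[of s] kappa_bounds by (intro exI[of _ "kappa + \<rho> s"]) auto
  qed
  \<comment> \<open>Equality holds at \<open>e = 0\<close>, and the difference of the two sides increases with \<open>e\<close>.\<close>
  define f where "f = (\<lambda>t. sweep (h + \<delta> t) - kappa * t)"
  have "f 0 \<le> f e"
  proof (rule DERIV_nonneg_imp_nondecreasing[OF e(1)])
    fix t assume t: "0 \<le> t" "t \<le> e"
    define z where "z = 1 - cos (h + \<delta> t)"
    have P: "1 + kappa * z > 0" unfolding z_def by (rule one_plus_kappa_pos)
    have "(f has_real_derivative sweep' (h + \<delta> t) * (kappa + \<rho> t) - kappa) (at t)"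
      unfolding f_def using t(1)
      by (auto intro!: derivative_eq_intros DERIV_chain2[OF DERIV_sweep] D\<delta>)
    moreover have "0 \<le> sweep' (h + \<delta> t) * (kappa + \<rho> t) - kappa"
    proof -
      have "kappa * t \<le> kappa * e" using t kappa_bounds by simp
      then have "kappa * t \<le> sweep h" using e(3) by simp
      then have "t \<le> 4 / 3 * tan (h / 2) ^ 3" using le_tan_cubed_of_le_sweep h by simp
      then have "(y + t)\<^sup>2 \<le> z * (y + y * t + t\<^sup>2 / 2)"
        using grace_derivative_bound[of h t] h t e(2) le \<delta>_mono[OF t] unfolding z_def y_def \<delta>_def by auto
      then have "1 \<le> z * \<rho> t" using y t by (simp add: \<rho>_def le_divide_eq)
      then have "1 + kappa * z \<le> z * (kappa + \<rho> t)" by (simp add: algebra_simps)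
      then have "kappa * (1 + kappa * z) \<le> kappa * (z * (kappa + \<rho> t))"
        using kappa_bounds by (intro mult_left_mono) auto
      then show ?thesis using P unfolding sweep'_def z_def[symmetric] by (simp add: field_simps)
    qed
    ultimately show "\<exists>y. (f has_real_derivative y) (at t) \<and> 0 \<le> y" by blast
  qed
  then show ?thesis by (simp add: f_def \<delta>_def grace_def)
qed

subsection \<open>The arc starting in the direction of the queen\<close>

lemma one_minus_sweep': "1 - sweep' s = 1 / (1 + kappa * (1 - cos s))"
  using one_plus_kappa_pos[of s] by (simp add: sweep'_def field_simps)

text \<open>On the first arc \<open>e\<close> is \<open>sweep b / kappa\<close>, and
  \<open>b - sweep b\<close> is the length left after the waiting time is deducted. This identity
  relates their derivatives.\<close>

lemma sweep'_div_kappa: "sweep' s / kappa = (1 - cos s) * (1 - sweep' s)"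
  unfolding one_minus_sweep' using kappa_bounds by (simp add: sweep'_def)

lemma one_minus_sweep'_pos: "0 < 1 - sweep' s"
  unfolding one_minus_sweep' using one_plus_kappa_pos[of s] by simp

lemma DERIV_lag: "((\<lambda>s. s - sweep s) has_real_derivative 1 - sweep' s) (at s)"
  by (intro DERIV_diff DERIV_ident DERIV_sweep)

lemma lag_mono: "s \<le> t \<Longrightarrow> s - sweep s \<le> t - sweep t"
  by (erule DERIV_nonneg_imp_nondecreasing)
    (use DERIV_lag one_minus_sweep'_pos in \<open>blast intro: less_imp_le\<close>)

lemma sweep_nonneg: "0 \<le> s \<Longrightarrow> 0 \<le> sweep s"
  using DERIV_nonneg_imp_nondecreasing[of 0 s sweep] DERIV_sweep sweep'_nonneg
  by (metis sweep_0)

text \<open>With \<open>w s = s - sweep s\<close>, the two sides grow at rates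
  \<open>1 - cos (w s)\<close> and \<open>1 - cos s\<close> times the derivative of
  \<open>w\<close>, and \<open>0 \<le> w s \<le> s\<close>.\<close>

lemma lag_sin_bound:
  assumes "0 \<le> b" "b \<le> pi"
  shows "(b - sweep b) - sin (b - sweep b) \<le> sweep b / kappa"
proof -
  define w where "w = (\<lambda>s. s - sweep s)"
  define f where "f = (\<lambda>s. sweep s / kappa - (w s - sin (w s)))"
  have "f 0 \<le> f b"
  proof (rule DERIV_nonneg_imp_nondecreasing[OF assms(1)])
    fix s assume s: "0 \<le> s" "s \<le> b"
    have w: "0 \<le> w s" "w s \<le> s" using lag_mono[OF s(1)] sweep_nonneg[OF s(1)] by (simp_all add: w_def)
    have Dw: "(w has_real_derivative 1 - sweep' s) (at s)" unfolding w_def by (rule DERIV_lag)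
    have "(f has_real_derivative sweep' s / kappa - ((1 - sweep' s) - cos (w s) * (1 - sweep' s))) (at s)"
      unfolding f_def
      by (intro DERIV_diff DERIV_cdivide DERIV_sweep Dw DERIV_chain2[OF DERIV_sin])
    moreover have "sweep' s / kappa - ((1 - sweep' s) - cos (w s) * (1 - sweep' s))
        = (cos (w s) - cos s) * (1 - sweep' s)"
      unfolding sweep'_div_kappa by (simp add: algebra_simps)
    moreover have "cos s \<le> cos (w s)" using w s assms by (intro cos_monotone_0_pi_le) auto
    ultimately show "\<exists>y. (f has_real_derivative y) (at s) \<and> 0 \<le> y"
      using one_minus_sweep'_pos[of s] by (auto intro!: exI)
  qed
  then show ?thesis by (simp add: f_def w_def)
qed

text \<open>The difference \<open>f\<close> decreases up to \<open>pi\<close>, where it is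
  \<open>pi * (kappa - 3)\<close>, about \<open>-1.84\<close>.\<close>

lemma lag_linear_bound:
  assumes "b \<le> pi"
  shows "2 * (b - sweep b - 1) \<le> sweep b / kappa"
proof -
  define f where "f = (\<lambda>s. sweep s / kappa - 2 * (s - sweep s))"
  have "f pi \<le> f b"
  proof (rule DERIV_nonpos_imp_nonincreasing[OF assms])
    fix s
    have "(f has_real_derivative sweep' s / kappa - 2 * (1 - sweep' s)) (at s)"
      unfolding f_def by (intro DERIV_diff DERIV_cdivide DERIV_cmult DERIV_lag DERIV_sweep)
    moreover have "sweep' s / kappa - 2 * (1 - sweep' s) = - ((1 + cos s) * (1 - sweep' s))"
      unfolding sweep'_div_kappa by (simp add: algebra_simps)
    moreover have "0 \<le> 1 + cos s" using cos_ge_minus_one[of s] by linarith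
    ultimately show "\<exists>y. (f has_real_derivative y) (at s) \<and> y \<le> 0"
      using one_minus_sweep'_pos[of s] by (auto intro!: exI)
  qed
  moreover have "- 2 \<le> f pi"
  proof -
    have div: "x / kappa = x * (kappa - 2)" for x
    proof -
      have "x * (kappa - 2) * kappa = x" using kappa_sq by algebra
      then show ?thesis using kappa_bounds by (simp add: divide_eq_eq)
    qed
    have "f pi = (3 - kappa) * pi * (kappa - 2) - 2 * (pi - (3 - kappa) * pi)"
      by (simp add: f_def sweep_pi div)
    also have "\<dots> = pi * (kappa - 3)" using kappa_sq by algebra
    also have "\<dots> \<ge> 3.2 * (24 / 10 - 3)"
    proof -
      have "pi * (3 - kappa) \<le> 3.2 * (3 - 24 / 10)"
        using pi_approx kappa_bounds by (intro mult_mono) auto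
      then show ?thesis by (simp add: algebra_simps)
    qed
    finally show ?thesis by simp
  qed
  ultimately show ?thesis by (simp add: f_def)
qed

text \<open>Taylor expansion with fifth-order remainder:
  \<open>1 / 6 - 2 / 120 = 15 / 100\<close>.\<close>

lemma x_minus_sin_ge:
  fixes x :: real
  assumes "0 \<le> x" "x\<^sup>2 \<le> 2"
  shows "15 / 100 * x ^ 3 \<le> x - sin x"
proof -
  have "\<bar>sin x - (\<Sum>m<5. sin_coeff m * x ^ m)\<bar> \<le> inverse (fact 5) * \<bar>x\<bar> ^ 5"
    by (rule Maclaurin_sin_bound)
  moreover have "(\<Sum>m<5. sin_coeff m * x ^ m) = x - x ^ 3 / 6"
  proof -
    have "{..<5::nat} = {0, 1, 2, 3, 4}" by auto
    then show ?thesis by (simp add: sin_coeff_def fact_numeral)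
  qed
  moreover have "inverse (fact 5 :: real) = 1 / 120" by (simp add: fact_numeral)
  ultimately have "\<bar>sin x - (x - x ^ 3 / 6)\<bar> \<le> x ^ 5 / 120" using assms(1) by simp
  then have "sin x \<le> x - x ^ 3 / 6 + x ^ 5 / 120" by linarith
  moreover have "x ^ 5 \<le> 2 * x ^ 3"
    using mult_right_mono[OF assms(2), of "x ^ 3"] assms(1) by (simp add: power_add[symmetric])
  moreover have "0 \<le> x ^ 3" using assms by simp
  ultimately show ?thesis by linarith
qed

text \<open>The first-order deadline is unbounded near \<open>s = 0\<close>, where
  \<open>sweep_grace\<close> does not apply. Since \<open>1 - cos s \<le> s\<^sup>2 / 2\<close>, for
  \<open>s < V\<close> it suffices that
  \<open>(V - s) * (2 * e + s\<^sup>2) \<le> 2 * e + e\<^sup>2\<close>; \<open>cube\<close> and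
  \<open>lin\<close> bound \<open>e\<close> from below in terms of \<open>V\<close>.\<close>

lemma first_arc:
  assumes s: "0 \<le> s" "s \<le> b" "b \<le> pi" and b: "sweep b = kappa * e" and e: "0 < e"
  shows "b - s \<le> kappa * e + grace e s"
proof -
  define V where "V = b - kappa * e"
  have eV: "e = sweep b / kappa" using b kappa_bounds by simp
  have V: "V = b - sweep b" by (simp add: V_def b)
  have V0: "0 \<le> V" using lag_mono[of 0 b] s by (simp add: V)
  have V1: "V\<^sup>2 \<le> 2"
  proof -
    have "V \<le> (kappa - 2) * pi" using lag_mono[of b pi] s by (simp add: V sweep_pi algebra_simps)
    also have "\<dots> \<le> 42 / 100 * 3.2" using pi_approx kappa_bounds by (intro mult_mono) auto
    finally have "V\<^sup>2 \<le> (42 / 100 * 3.2)\<^sup>2" using V0 by (rule power_mono)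
    then show ?thesis by (simp add: power2_eq_square)
  qed
  have cube: "3 / 10 * V ^ 3 \<le> 2 * e"
    using x_minus_sin_ge[OF V0 V1] lag_sin_bound[of b] s by (simp add: V eV)
  have lin: "2 * (V - 1) \<le> e" using lag_linear_bound[of b] s by (simp add: V eV)
  have "V - s \<le> grace e s"
  proof (cases "V \<le> s")
    case True
    then show ?thesis using grace_nonneg[of e s] e by linarith
  next
    case False
    have am: "(V - s) * s \<le> V\<^sup>2 / 4"
      using zero_le_power2[of "V / 2 - s"] by (simp add: power2_eq_square field_simps)
    have "(V - s) * s\<^sup>2 \<le> 2 * e * (1 - V + s) + e\<^sup>2"
    \<comment> \<open>For \<open>V \<le> 1\<close> the factor \<open>1 - V + s\<close> is at least
      \<open>s / V\<close>. For \<open>V > 1\<close> the negative term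
      \<open>2 * e * (1 - V)\<close> is absorbed by \<open>e\<^sup>2\<close> through
      \<open>lin\<close>.\<close>
    proof (cases "V \<le> 1")
      case True
      have "(V - s) * s\<^sup>2 = ((V - s) * s) * s" by (simp add: power2_eq_square)
      also have "\<dots> \<le> (3 / 10 * V\<^sup>2) * s"
      proof (rule mult_right_mono)
        show "(V - s) * s \<le> 3 / 10 * V\<^sup>2" using am zero_le_power2[of V] by linarith
      qed (rule s)
      also have "\<dots> \<le> (3 / 10 * V\<^sup>2) * (V * (1 - V + s))"
      proof (rule mult_left_mono)
        have "0 \<le> (1 - V) * (V - s)" using True False by simp
        then show "s \<le> V * (1 - V + s)" by (simp add: algebra_simps)
      qed simp
      also have "\<dots> = (3 / 10 * V ^ 3) * (1 - V + s)" by (simp add: power2_eq_square power3_eq_cube)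
      also have "\<dots> \<le> 2 * e * (1 - V + s)" using cube True s by (intro mult_right_mono) auto
      finally show ?thesis using zero_le_power2[of e] by linarith
    next
      case False
      then have "V\<^sup>2 / 4 \<le> 3 / 10 * V ^ 3"
        by (simp add: power2_eq_square power3_eq_cube field_simps)
      then have "(V - s) * s \<le> 2 * e" using am cube by linarith
      then have "(V - s) * s * s \<le> 2 * e * s" using s by (intro mult_right_mono) auto
      moreover have "0 \<le> e * (e - 2 * (V - 1))" using e lin by simp
      ultimately show ?thesis by (simp add: power2_eq_square algebra_simps)
    qed
    then have main: "(V - s) * (2 * e + s\<^sup>2) \<le> 2 * e + e\<^sup>2" by (simp add: algebra_simps)
    have "\<bar>sin (s / 2)\<bar> \<le> \<bar>s / 2\<bar>" by (rule abs_sin_x_le_abs_x)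
    then have "(sin (s / 2))\<^sup>2 \<le> (s / 2)\<^sup>2" by (simp only: abs_le_square_iff)
    then have c: "2 * (1 - cos s) \<le> s\<^sup>2"
      using one_minus_cos_half[of s] by (simp add: power_divide)
    have c1: "0 \<le> 1 - cos s" by simp
    have "(V - s) * (2 * (1 + e - cos s)) \<le> (V - s) * (2 * e + s\<^sup>2)"
      using False c by (intro mult_left_mono) auto
    also have "(V - s) * (2 * (1 + e - cos s)) = 2 * ((V - s) * (1 + e - cos s))" by simp
    finally have "(V - s) * (1 + e - cos s) \<le> e + e\<^sup>2 / 2" using main by linarith
    moreover have "0 < 1 + e - cos s" using c1 e by linarith
    ultimately show ?thesis by (simp add: grace_def le_divide_eq)
  qed
  then show ?thesis by (simp add: V_def)
qed

subsection \<open>The arc around the antipode when the number of servants is odd\<close>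

text \<open>The arc from \<open>2 * pi - s\<close> to \<open>s\<close> is finished at
  \<open>s\<close>. It is shrunk to the antipode, with \<open>E t\<close> the step that fits the arc
  ending at \<open>t\<close>: deadline minus length is \<open>0\<close> at \<open>pi\<close> and
  nonincreasing in \<open>t\<close>.\<close>

lemma middle_half_arc:
  assumes s: "pi / 2 \<le> s" "s \<le> pi" and e: "kappa * e = 2 * (sweep pi - sweep s)"
  shows "2 * (pi - s) \<le> kappa * e + grace e s"
proof -
  define E where "E = (\<lambda>t. 2 * (sweep pi - sweep t) / kappa)"
  define f where "f = (\<lambda>t. kappa * E t + grace (E t) t - 2 * (pi - t))"
  have k: "kappa > 0" using kappa_bounds by simp
  have "f pi \<le> f s"
  proof (rule DERIV_nonpos_imp_nonincreasing[OF s(2)])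
    fix t assume t: "s \<le> t" "t \<le> pi"
    define q where "q = 1 - cos t"
    define v where "v = 1 - sweep' t"
    have q1: "1 \<le> q" unfolding q_def using t s cos_monotone_0_pi_le[of "pi / 2" t] by simp
    have v0: "0 < v" unfolding v_def by (rule one_minus_sweep'_pos)
    have kv: "(1 + kappa * q) * v = 1"
      using one_plus_kappa_pos[of t] by (simp add: v_def q_def one_minus_sweep')
    have "v \<le> 1 / 2"
    proof -
      have "2 * v \<le> (1 + kappa * q) * v"
        using v0 kappa_bounds mult_mono[of 1 kappa 1 q] q1 by (intro mult_right_mono) auto
      then show ?thesis using kv by simp
    qed
    have E0: "0 \<le> E t"
      unfolding E_def using sweep_le_iff[of t pi] t s k by (intro divide_nonneg_pos) auto
    have DE: "(E has_real_derivative - (2 * (q * v))) (at t)"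
    proof -
      have "(E has_real_derivative 2 * (0 - sweep' t) / kappa) (at t)"
        unfolding E_def by (intro DERIV_cdivide DERIV_cmult DERIV_diff DERIV_const DERIV_sweep)
      moreover have "2 * (0 - sweep' t) / kappa = - (2 * (sweep' t / kappa))" by simp
      ultimately show ?thesis unfolding sweep'_div_kappa q_def v_def by simp
    qed
    define e where "e = E t"
    have e0: "0 \<le> e" using E0 by (simp add: e_def)
    define d where "d = - (2 * (q * v))"
    define N where "N = (d + e * d) * (q + e) - (e + e\<^sup>2 / 2) * (d + sin t)"
    have den: "0 < q + e" and gE: "1 + E t - cos t = q + e"
      using q1 e0 by (simp_all add: q_def e_def)
    have "((\<lambda>t. E t + (E t)\<^sup>2 / 2) has_real_derivative d + e * d) (at t)"
      by (rule DERIV_cong[OF DERIV_add[OF DE DERIV_cdivide[OF DERIV_power[OF DE, of 2], of 2]]])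
        (simp add: d_def e_def)
    moreover have "((\<lambda>t. 1 + E t - cos t) has_real_derivative d + sin t) (at t)"
      by (rule DERIV_cong[OF DERIV_diff[OF DERIV_add[OF DERIV_const DE] DERIV_cos]])
        (simp add: d_def)
    ultimately have "((\<lambda>t. grace (E t) t) has_real_derivative
        ((d + e * d) * (1 + E t - cos t) - (E t + (E t)\<^sup>2 / 2) * (d + sin t))
          / ((1 + E t - cos t) * (1 + E t - cos t))) (at t)"
      unfolding grace_def by (rule DERIV_divide) (use den gE in simp)
    then have "((\<lambda>t. grace (E t) t) has_real_derivative N / ((q + e) * (q + e))) (at t)"
      unfolding gE unfolding e_def[symmetric] N_def .
    then have "(f has_real_derivative kappa * d + N / ((q + e) * (q + e)) - 2 * (0 - 1)) (at t)"
      unfolding f_def d_def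
      by (intro DERIV_diff DERIV_add DERIV_cmult DERIV_const DERIV_ident DE)
    moreover have "kappa * d + N / ((q + e) * (q + e)) - 2 * (0 - 1) \<le> 0"
    proof -
      have D: "0 < (q + e) * (q + e)" using den by simp
      have A: "kappa * d + 2 = 2 * v" using kv by (simp add: d_def algebra_simps)
      have s2: "(sin t)\<^sup>2 = q * (2 - q)"
        using sin_squared_eq[of t] by (simp add: q_def power2_eq_square algebra_simps)
      have st: "0 \<le> sin t" using t s pi_gt_zero by (intro sin_ge_zero) linarith+
      \<comment> \<open>By \<open>A\<close> this is the numerator of the derivative. It is at most a
        nonnegative multiple of \<open>2 * v * sin t - 1\<close>, which \<open>v \<le> 1 / 2\<close>
        makes nonpositive.\<close>
      have "2 * v * ((q + e) * (q + e)) + N = 2 * v * (2 - q) * (q * e + e\<^sup>2 / 2) - (e + e\<^sup>2 / 2) * sin t"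
        unfolding N_def d_def by (simp add: power2_eq_square field_simps)
      also have "\<dots> \<le> 2 * v * (2 - q) * (q * (e + e\<^sup>2 / 2)) - (e + e\<^sup>2 / 2) * sin t"
      proof -
        have "e\<^sup>2 / 2 \<le> q * (e\<^sup>2 / 2)" using q1 by (simp add: mult_le_cancel_right1)
        then have "q * e + e\<^sup>2 / 2 \<le> q * (e + e\<^sup>2 / 2)" by (simp add: algebra_simps)
        moreover have "0 \<le> 2 - q" unfolding q_def using cos_ge_minus_one[of t] by linarith
        ultimately show ?thesis using v0 by (intro diff_right_mono mult_left_mono) auto
      qed
      also have "\<dots> = (e + e\<^sup>2 / 2) * sin t * (2 * v * sin t - 1)"
      proof -
        have "2 * v * (2 - q) * (q * G) - G * sin t = G * sin t * (2 * v * sin t - 1)" for G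
          using s2 by algebra
        then show ?thesis .
      qed
      also have "\<dots> \<le> 0"
      proof (rule mult_nonneg_nonpos)
        have "2 * v * sin t \<le> 1 * 1" using \<open>v \<le> 1 / 2\<close> v0 st by (intro mult_mono) auto
        then show "2 * v * sin t - 1 \<le> 0" by simp
      qed (use e0 st in simp)
      finally have "N / ((q + e) * (q + e)) \<le> - (2 * v)"
        using D by (simp add: pos_divide_le_eq)
      moreover have "x + y - 2 * (0 - 1) \<le> 0" if "y \<le> - z" "x + 2 = z" for x y z :: real
        using that by simp
      ultimately show ?thesis using A by blast
    qed
    ultimately show "\<exists>y. (f has_real_derivative y) (at t) \<and> y \<le> 0" by blast
  qed
  moreover have "f pi = 0" by (simp add: f_def E_def grace_def)
  moreover have "E s = e" using e k by (simp add: E_def field_simps)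
  ultimately show ?thesis by (simp add: f_def)
qed

text \<open>The end \<open>a\<close> is critical. From \<open>a\<close> to \<open>pi\<close> the
  length drops at unit rate and \<open>grace\<close> no faster, as \<open>cos \<le> 0\<close> keeps
  the denominators at least \<open>1 + e\<close>. Beyond \<open>pi\<close> the length drops further,
  while \<open>grace\<close> stays at least its value at \<open>pi\<close>.\<close>

lemma middle_arc:
  assumes a: "pi / 2 \<le> a" "a \<le> pi" and e: "kappa * e = 2 * (sweep pi - sweep a)"
    and s: "a \<le> s"
  shows "2 * pi - a - s \<le> kappa * e + grace e s"
proof -
  have k: "kappa > 0" using kappa_bounds by simp
  have "0 \<le> kappa * e" unfolding e using sweep_le_iff[of a pi] a pi_gt_zero by simp
  then have e0: "0 \<le> e" using k by (simp add: zero_le_mult_iff)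
  have half: "2 * pi - a - s \<le> kappa * e + grace e s" if s: "a \<le> s" "s \<le> pi" for s
  proof -
    define p where "p = 1 + e - cos a"
    define q where "q = 1 + e - cos s"
    have ca: "cos a \<le> 0" using a cos_monotone_0_pi_le[of "pi / 2" a] by simp
    have cs: "cos s \<le> cos a" using a s by (intro cos_monotone_0_pi_le) auto
    have p: "1 + e \<le> p" "1 + e \<le> q" "p \<le> q" using ca cs by (simp_all add: p_def q_def)
    have lip: "cos a - cos s \<le> s - a"
    proof -
      have "(\<lambda>t. cos t + t) a \<le> (\<lambda>t. cos t + t) s"
        using s(1) by (rule DERIV_nonneg_imp_nondecreasing)
          (auto intro!: exI derivative_eq_intros simp: algebra_simps)
      then show ?thesis by simp
    qed
    have "grace e a - grace e s = (e + e\<^sup>2 / 2) / (p * q) * (cos a - cos s)"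
      unfolding grace_def p_def[symmetric] q_def[symmetric] using p e0
      by (simp add: field_simps) (simp add: p_def q_def algebra_simps)
    also have "\<dots> \<le> 1 * (cos a - cos s)"
    proof (rule mult_right_mono)
      have "e + e\<^sup>2 / 2 \<le> (1 + e) * (1 + e)" using e0 by (simp add: power2_eq_square algebra_simps)
      also have "\<dots> \<le> p * q" using p e0 by (intro mult_mono) auto
      finally show "(e + e\<^sup>2 / 2) / (p * q) \<le> 1" using p e0 by (simp add: divide_le_eq_1)
    qed (use cs in simp)
    finally have "grace e a - grace e s \<le> s - a" using lip by simp
    moreover have "2 * (pi - a) \<le> kappa * e + grace e a" by (rule middle_half_arc[OF a e])
    ultimately show ?thesis by (simp add: algebra_simps)
  qed
  show ?thesis
  proof (cases "s \<le> pi")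
    case True
    with half s show ?thesis by blast
  next
    case False
    have "grace e pi \<le> grace e s"
    \<comment> \<open>For \<open>e = 0\<close> the denominator may vanish, but the numerator makes
      \<open>grace\<close> zero everywhere.\<close>
    proof (cases "e = 0")
      case False
      with e0 have "0 < 1 + e - cos s" using cos_le_one[of s] by linarith
      then show ?thesis
        unfolding grace_def using e0 by (intro divide_left_mono mult_pos_pos) auto
    qed (simp add: grace_def)
    then show ?thesis using half[of pi] a False by simp
  qed
qed

lemma sweep_half_pi_le: "sweep (pi / 2) \<le> sweep pi / 2"
  using kappa_bounds by (simp add: sweep_def)

text \<open>Were the length searched before \<open>cis s\<close> above the deadline,
  \<open>sweep_grace\<close> would give it more than \<open>kappa * e\<close> of
  \<open>sweep\<close>.\<close>

lemma later_arc:
  assumes s: "0 < s" "s \<le> b" "b \<le> pi" and e: "0 \<le> e" "e \<le> 1" "kappa * e \<le> sweep s"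
    and b: "sweep b \<le> sweep s + kappa * e"
  shows "b - s \<le> kappa * e + grace e s"
proof (rule ccontr)
  assume "\<not> b - s \<le> kappa * e + grace e s"
  then have lt: "s + (kappa * e + grace e s) < b" by simp
  have nn: "0 \<le> kappa * e + grace e s" using grace_nonneg e kappa_bounds by simp
  have "sweep s + kappa * e \<le> sweep (s + (kappa * e + grace e s))"
    using s e lt nn by (intro sweep_grace) linarith+
  also have "\<dots> < sweep b"
    using s lt nn pi_gt_zero by (intro sweep_strict_mono) linarith+
  finally show False using b by simp
qed

subsection \<open>Trajectories and arrival times\<close>

definition queen_path :: "real \<Rightarrow> real \<Rightarrow> complex" where
  "queen_path w t = of_real (max 0 (t - 1 - w))"

text \<open>The angle decreases from the upper end \<open>b\<close> of an arc. The path need not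
  stop at the lower end: early discoveries do no harm, by \<open>arrival_time_le\<close>.\<close>

definition servant_path :: "real \<Rightarrow> real \<Rightarrow> complex" where
  "servant_path b t = of_real (min t 1) * cis (b - max 0 (t - 1))"

lemma norm_cis_diff_le: "norm (cis a - cis b) \<le> \<bar>a - b\<bar>"
proof -
  have "cis a - cis b = cis b * (exp (\<i> * of_real (a - b)) - 1)"
    by (simp add: cis_conv_exp exp_add[symmetric] algebra_simps)
  then have "norm (cis a - cis b) = 2 * \<bar>sin ((a - b) / 2)\<bar>"
    by (simp add: norm_mult dist_exp_i_1 del: of_real_diff)
  also have "\<dots> \<le> 2 * \<bar>(a - b) / 2\<bar>" by (intro mult_left_mono abs_sin_x_le_abs_x) simp
  finally show ?thesis by simp
qed

lemma lipschitz_queen_path: "1-lipschitz_on S (queen_path w)"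
proof (rule lipschitz_onI)
  fix s t
  have "dist (queen_path w s) (queen_path w t) = \<bar>max 0 (s - 1 - w) - max 0 (t - 1 - w)\<bar>"
    unfolding queen_path_def dist_norm by (simp flip: of_real_diff)
  then show "dist (queen_path w s) (queen_path w t) \<le> 1 * dist s t"
    by (simp add: dist_real_def)
qed simp

lemma lipschitz_servant_path: "1-lipschitz_on {0..} (servant_path b)"
proof -
  have "dist (servant_path b s) (servant_path b t) \<le> t - s" if "0 \<le> s" "s \<le> t" for s t
  proof -
    let ?m = "\<lambda>t. min t (1::real)" and ?M = "\<lambda>t. max 0 (t - (1::real))"
    \<comment> \<open>Radius and angle change one after the other, so the two increments add up to
      exactly \<open>t - s\<close>.\<close>
    have "servant_path b s - servant_path b t
        = of_real (?m s) * (cis (b - ?M s) - cis (b - ?M t)) + of_real (?m s - ?m t) * cis (b - ?M t)"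
      by (simp add: servant_path_def algebra_simps)
    also have "norm \<dots> \<le> \<bar>?m s\<bar> * norm (cis (b - ?M s) - cis (b - ?M t)) + \<bar>?m s - ?m t\<bar>"
      by (rule order_trans[OF norm_triangle_ineq]) (simp add: norm_mult del: of_real_diff)
    also have "\<dots> \<le> 1 * \<bar>(b - ?M s) - (b - ?M t)\<bar> + \<bar>?m s - ?m t\<bar>"
      using that by (intro add_right_mono mult_mono norm_cis_diff_le) auto
    also have "\<dots> = t - s" using that by auto
    finally show ?thesis by (simp add: dist_norm)
  qed
  note le = this
  show ?thesis
  proof (rule lipschitz_onI)
    fix s t :: real assume "s \<in> {0..}" "t \<in> {0..}"
    then show "dist (servant_path b s) (servant_path b t) \<le> 1 * dist s t"
      using le[of s t] le[of t s] by (cases "s \<le> t") (simp_all add: dist_real_def dist_commute)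
  qed simp
qed

lemma lipschitz_on_cnj: "C-lipschitz_on S f \<Longrightarrow> C-lipschitz_on S (\<lambda>t. cnj (f t))"
  by (simp add: lipschitz_on_def dist_norm flip: complex_cnj_diff)

text \<open>While she waits, the distance is \<open>1\<close>. Afterwards
  \<open>dist \<le> 1 + e - q\<close> is, once squared, the condition
  \<open>q \<le> grace e s\<close>; squaring is allowed because
  \<open>q \<le> 1 + e / 2\<close>.\<close>

lemma queen_arrival:
  assumes e: "0 < e" and w: "0 \<le> w" and t: "t \<le> w + grace e s"
  shows "(1 + t) + dist (queen_path w (1 + t)) (cis s) \<le> 2 + w + e"
proof (cases "t \<le> w")
  case True
  then show ?thesis using e by (simp add: queen_path_def)
next
  case False
  define q where "q = t - w"
  have q: "0 < q" "q \<le> grace e s" using False t by (simp_all add: q_def)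
  have c: "e \<le> 1 + e - cos s" by simp
  have qd: "q * (1 + e - cos s) \<le> e + e\<^sup>2 / 2"
    using q(2) c e unfolding grace_def by (simp add: pos_le_divide_eq)
  have "q * e \<le> q * (1 + e - cos s)" using q c by (intro mult_left_mono) auto
  also note qd
  also have "e + e\<^sup>2 / 2 = (1 + e / 2) * e" by (simp add: power2_eq_square algebra_simps)
  finally have "q \<le> 1 + e / 2" using e by simp
  then have q1: "0 \<le> 1 + e - q" using e by linarith
  have "(norm (of_real q - cis s))\<^sup>2 = q\<^sup>2 - 2 * q * cos s + ((cos s)\<^sup>2 + (sin s)\<^sup>2)"
    unfolding cmod_power2 by (simp add: power2_eq_square algebra_simps)
  also have "\<dots> \<le> (1 + e - q)\<^sup>2"
    using qd by (simp add: power2_eq_square algebra_simps)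
  finally have "norm (of_real q - cis s) \<le> 1 + e - q" using q1 by (rule power2_le_imp_le)
  moreover have "queen_path w (1 + t) = of_real q" using q by (simp add: queen_path_def q_def)
  ultimately show ?thesis by (simp add: dist_norm q_def)
qed

text \<open>Between discovery and \<open>t\<close> the queen moves at most by the elapsed time, so
  the triangle inequality applies. Hence one visit in time suffices for each point, first or
  not.\<close>

lemma arrival_time_le:
  assumes A: "valid_algorithm n A" and r: "r \<in> robots n" "0 \<le> t" "A r t = x"
  shows "queen_arrival_time n A x \<le> t + dist (A Queen t) x"
proof -
  let ?V = "{t. 0 \<le> t \<and> (\<exists>r\<in>robots n. A r t = x)}"
  define d where "d = discovery_time n A x"
  have "t \<in> ?V" using r by blast
  then have d: "0 \<le> d" "d \<le> t"
    unfolding d_def discovery_time_def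
    by (auto intro!: cInf_greatest cInf_lower bdd_belowI[of _ 0])
  have "1-lipschitz_on {0..} (A Queen)" using A by (simp add: valid_algorithm_def robots_def)
  then have "dist (A Queen d) (A Queen t) \<le> t - d"
    using lipschitz_onD[of 1 "{0..}" "A Queen" d t] d by (simp add: dist_real_def)
  then have "d + dist (A Queen d) x \<le> t + dist (A Queen t) x"
    using dist_triangle[of "A Queen d" x "A Queen t"] by linarith
  then show ?thesis by (simp add: queen_arrival_time_def d_def)
qed

lemma solves_PE_evacuation_time_le:
  assumes A: "valid_algorithm n A"
    and visit: "\<And>x. x \<in> sphere 0 1 \<Longrightarrow>
      \<exists>r\<in>robots n. \<exists>t\<ge>0. A r t = x \<and> t + dist (A Queen t) x \<le> T"
  shows "solves_PE n A \<and> evacuation_time n A \<le> ereal T"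
proof
  have "\<exists>r\<in>robots n. \<exists>t\<in>{0..T}. A r t = x" if x: "x \<in> sphere 0 1" for x
  proof -
    obtain r t where "r \<in> robots n" "0 \<le> t" "A r t = x" "t + dist (A Queen t) x \<le> T"
      using visit[OF x] by blast
    moreover from this have "t \<le> T" using zero_le_dist[of "A Queen t" x] by linarith
    ultimately show ?thesis by (metis atLeastAtMost_iff)
  qed
  moreover have "0 \<le> T"
  proof -
    obtain t where "0 \<le> t" "t + dist (A Queen t) 1 \<le> T" using visit[of 1] by auto
    then show ?thesis using zero_le_dist[of "A Queen t" 1] by linarith
  qed
  ultimately show "solves_PE n A" using A by (auto simp: solves_PE_def)
  show "evacuation_time n A \<le> ereal T"
    unfolding evacuation_time_def
  proof (rule SUP_least)
    fix x :: complex assume "x \<in> sphere 0 1"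
    then obtain r t where "r \<in> robots n" "0 \<le> t" "A r t = x" "t + dist (A Queen t) x \<le> T"
      using visit by blast
    with arrival_time_le[OF A] show "ereal (queen_arrival_time n A x) \<le> ereal T" by force
  qed
qed

subsection \<open>The partition of the circle\<close>

text \<open>\<open>total\<close> determines \<open>e\<close> from \<open>n\<close>; the
  \<open>b k\<close> are the ends of \<open>n\<close> arcs of equal \<open>sweep\<close>, counted
  from the direction of the queen.\<close>

locale partition =
  fixes n :: nat and e :: real and b :: "nat \<Rightarrow> real"
  assumes n: "4 \<le> n"
    and total: "real n * (kappa * e) = 2 * sweep pi"
    and b_range: "k \<le> n \<Longrightarrow> 0 \<le> b k \<and> b k \<le> 2 * pi"
    and sweep_b: "k \<le> n \<Longrightarrow> sweep (b k) = real k * (kappa * e)"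
begin

lemma step_pos: "0 < kappa * e"
proof -
  have "0 < real n * (kappa * e)" unfolding total sweep_pi using kappa_bounds pi_gt_zero by simp
  then show ?thesis using n by (simp add: zero_less_mult_iff)
qed

lemma e_pos: "0 < e"
  using step_pos kappa_bounds by (simp add: zero_less_mult_iff)

lemma e_le_1: "e \<le> 1"
proof -
  \<comment> \<open>At least four arcs share a total below \<open>3.84\<close>.\<close>
  have "4 * (kappa * e) \<le> real n * (kappa * e)"
    using n step_pos by (intro mult_right_mono) auto
  also have "\<dots> \<le> 2 * (6 / 10 * 3.2)"
    unfolding total sweep_pi using kappa_bounds pi_approx by (intro mult_left_mono mult_mono) auto
  finally have "kappa * e \<le> 1" by simp
  moreover have "1 * e \<le> kappa * e" using kappa_bounds e_pos by (intro mult_right_mono) auto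
  ultimately show ?thesis by simp
qed

lemma b_mono: "j \<le> k \<Longrightarrow> k \<le> n \<Longrightarrow> b j \<le> b k"
  using sweep_le_iff[of "b j" "b k"] b_range[of j] b_range[of k] sweep_b[of j] sweep_b[of k]
    step_pos by (simp add: mult_right_mono)

lemma b_0: "b 0 = 0"
  using sweep_le_iff[of "b 0" 0] b_range[of 0] sweep_b[of 0] by simp

lemma b_reflect:
  assumes "k \<le> n"
  shows "b (n - k) = 2 * pi - b k"
proof -
  have "sweep (b (n - k)) = sweep (2 * pi - b k)"
    unfolding sweep_reflect using assms sweep_b[of k] sweep_b[of "n - k"] total
    by (simp add: of_nat_diff algebra_simps)
  then show ?thesis
    using sweep_le_iff[of "b (n - k)" "2 * pi - b k"] sweep_le_iff[of "2 * pi - b k" "b (n - k)"]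
      b_range[of k] b_range[of "n - k"] assms by simp
qed

lemma b_le_pi:
  assumes "2 * k \<le> n"
  shows "b k \<le> pi"
  using b_mono[of k "n - k"] b_reflect[of k] assms by simp

lemma arc_in_time:
  assumes k: "1 \<le> k" "2 * k \<le> n + 1" and s: "b (k - 1) \<le> s" "s \<le> b k"
  shows "b k - s \<le> kappa * e + grace e s"
proof -
  have kn: "k \<le> n" "k - 1 \<le> n" using k n by auto
  have s0: "0 \<le> s" using b_range[of "k - 1"] kn s by linarith
  \<comment> \<open>The arc at the direction of the queen, the other arcs up to the antipode, and
    for odd \<open>n\<close> the arc around the antipode.\<close>
  consider "k = 1" | "2 \<le> k" "2 * k \<le> n" | "2 * k = n + 1" using k by linarith
  then show ?thesis
  proof cases
    case 1
    then show ?thesis using first_arc[of s "b 1" e] b_le_pi[of 1] sweep_b[of 1] s s0 n e_pos by simp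
  next
    case 2
    have "real (k - 1) * (kappa * e) = sweep (b (k - 1))" using sweep_b[of "k - 1"] kn by simp
    also have "\<dots> \<le> sweep s"
      using sweep_le_iff[of "b (k - 1)" s] b_range[of "k - 1"] b_range[of k] kn s s0 by simp
    finally have lo: "real (k - 1) * (kappa * e) \<le> sweep s" .
    have "1 * (kappa * e) \<le> real (k - 1) * (kappa * e)"
      using 2 step_pos by (intro mult_right_mono) auto
    then have ge: "kappa * e \<le> sweep s" using lo by simp
    then have "0 < s" using step_pos s0 by (cases "s = 0") auto
    moreover have "sweep (b k) \<le> sweep s + kappa * e"
      using lo sweep_b[of k] kn k by (simp add: of_nat_diff algebra_simps)
    ultimately show ?thesis
      using later_arc[of s "b k" e] s b_le_pi[of k] 2 e_pos e_le_1 ge by simp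
  next
    case 3
    then have nk: "n - (k - 1) = k" using k by simp
    have bk: "b k = 2 * pi - b (k - 1)" using b_reflect[of "k - 1"] kn nk by simp
    have "2 * real (k - 1) + 1 = real n" using 3 k by (simp add: of_nat_diff)
    then have "2 * sweep pi = (2 * real (k - 1) + 1) * (kappa * e)" using total by simp
    then have half: "2 * sweep pi = 2 * (real (k - 1) * (kappa * e)) + kappa * e"
      by (simp add: distrib_right)
    have sb: "sweep (b (k - 1)) = real (k - 1) * (kappa * e)" using sweep_b kn by simp
    have "sweep (pi / 2) \<le> sweep pi / 2" by (rule sweep_half_pi_le)
    also have "\<dots> \<le> sweep (b (k - 1))"
    proof -
      \<comment> \<open>Since \<open>n \<ge> 4\<close>, a whole arc precedes the middle one, which
        pushes the latter beyond \<open>pi / 2\<close>.\<close>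
      have "1 \<le> real (k - 1)" using 3 n by (simp add: of_nat_diff)
      then have "1 * (kappa * e) \<le> real (k - 1) * (kappa * e)"
        using step_pos by (intro mult_right_mono) auto
      then show ?thesis using half sb step_pos by linarith
    qed
    finally have "pi / 2 \<le> b (k - 1)"
      using sweep_le_iff[of "pi / 2" "b (k - 1)"] b_range[of "k - 1"] kn by simp
    moreover have "b (k - 1) \<le> pi" using b_le_pi[of "k - 1"] 3 by simp
    moreover have "kappa * e = 2 * (sweep pi - sweep (b (k - 1)))"
      unfolding right_diff_distrib half sb by simp
    ultimately show ?thesis using middle_arc[of "b (k - 1)" e s] s bk by simp
  qed
qed

lemma arc_containing:
  assumes "0 \<le> s" "s \<le> b m" "1 \<le> m"
  obtains k where "1 \<le> k" "k \<le> m" "b (k - 1) \<le> s" "s \<le> b k"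
proof (cases "s \<le> b 1")
  \<comment> \<open>Treated apart because for \<open>s = 0\<close> the least index chosen below
    would be \<open>0\<close>.\<close>
  case True
  then show ?thesis using that[of 1] assms b_0 by simp
next
  case False
  define k where "k = (LEAST k. s \<le> b k)"
  have "s \<le> b k" unfolding k_def using assms(2) by (rule LeastI)
  moreover have "k \<le> m" unfolding k_def using assms(2) by (rule Least_le)
  moreover have "k \<noteq> 0"
  proof
    assume "k = 0"
    then have "s = 0" using \<open>s \<le> b k\<close> b_0 assms by simp
    then show False using False b_range[of 1] n by simp
  qed
  moreover have "b (k - 1) \<le> s"
    using not_less_Least[of "k - 1" "\<lambda>k. s \<le> b k"] \<open>k \<noteq> 0\<close> unfolding k_def[symmetric] by simp
  ultimately show ?thesis using that[of k] by simp
qed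

text \<open>Conjugation turns the search of arc \<open>n + 1 - k\<close> into that of its mirror
  image, arc \<open>k\<close>. For odd \<open>n\<close> the middle arc,
  \<open>2 * k = n + 1\<close>, is searched unreflected.\<close>

definition trajectory :: algorithm where
  "trajectory r = (case r of
      Queen \<Rightarrow> queen_path (kappa * e)
    | Servant k \<Rightarrow> if 2 * k \<le> n + 1 then servant_path (b k)
        else (\<lambda>t. cnj (servant_path (b (n + 1 - k)) t)))"

lemma valid_trajectory: "valid_algorithm n trajectory"
proof -
  have "queen_path (kappa * e) 0 = 0" "servant_path c 0 = 0" for c
    using step_pos by (simp_all add: queen_path_def servant_path_def)
  then have "trajectory r 0 = 0 \<and> 1-lipschitz_on {0..} (trajectory r)" for r
    using lipschitz_queen_path lipschitz_servant_path lipschitz_on_cnj[OF lipschitz_servant_path]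
    by (cases r) (simp_all add: trajectory_def)
  then show ?thesis by (simp add: valid_algorithm_def)
qed

lemma trajectory_visits:
  assumes "x \<in> sphere 0 1"
  shows "\<exists>r\<in>robots n. \<exists>t\<ge>0. trajectory r t = x \<and>
    t + dist (trajectory Queen t) x \<le> 2 + kappa * e + e"
proof -
  define s where "s = Arg2pi x"
  have s: "0 \<le> s" "s < 2 * pi" by (simp_all add: s_def Arg2pi)
  have x: "x = cis s"
    using Arg2pi_eq[of x] assms by (simp add: s_def cis_conv_exp)
  have Q: "trajectory Queen = queen_path (kappa * e)" by (simp add: trajectory_def)
  have servant: "servant_path c (1 + (c - \<phi>)) = cis \<phi>" if "\<phi> \<le> c" for c \<phi>
    using that by (simp add: servant_path_def)
  define m where "m = (n + 1) div 2"
  have m: "1 \<le> m" "m \<le> n" "2 * m \<le> n + 1" "n \<le> 2 * m" using n by (auto simp: m_def)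
  show ?thesis
  proof (cases "s \<le> b m")
    case True
    then obtain k where k: "1 \<le> k" "k \<le> m" "b (k - 1) \<le> s" "s \<le> b k"
      using arc_containing s m by metis
    have k2: "2 * k \<le> n + 1" using k m by simp
    show ?thesis
    proof (intro bexI[of _ "Servant k"] exI[of _ "1 + (b k - s)"] conjI)
      show "trajectory (Servant k) (1 + (b k - s)) = x"
        using k2 servant[OF k(4)] by (simp add: trajectory_def x)
      show "1 + (b k - s) + dist (trajectory Queen (1 + (b k - s))) x \<le> 2 + kappa * e + e"
        unfolding Q x using arc_in_time[OF k(1) k2 k(3,4)] e_pos step_pos
        by (intro queen_arrival) auto
    qed (use k m in \<open>auto simp: robots_def image_iff\<close>)
  next
    case False
    define u where "u = 2 * pi - s"
    have "u \<le> b (n - m)" using False b_reflect[of m] m by (simp add: u_def)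
    moreover have "1 \<le> n - m" using n by (simp add: m_def)
    moreover have "0 \<le> u" using s by (simp add: u_def)
    ultimately obtain k where k: "1 \<le> k" "k \<le> n - m" "b (k - 1) \<le> u" "u \<le> b k"
      using arc_containing by metis
    have k2: "2 * k \<le> n + 1" "\<not> 2 * (n + 1 - k) \<le> n + 1" "n + 1 - (n + 1 - k) = k"
      using k m by auto
    have xu: "x = cis (- u)" by (simp add: x u_def complex_eq_iff cos_diff sin_diff)
    show ?thesis
    proof (intro bexI[of _ "Servant (n + 1 - k)"] exI[of _ "1 + (b k - u)"] conjI)
      show "trajectory (Servant (n + 1 - k)) (1 + (b k - u)) = x"
        unfolding trajectory_def robot.case if_not_P[OF k2(2)] k2(3) servant[OF k(4)]
        by (simp add: xu cis_cnj)
      \<comment> \<open>\<open>grace e\<close> is even, so mirrored points have equal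
        deadlines.\<close>
      have "b k - u \<le> kappa * e + grace e (- u)"
        using arc_in_time[OF k(1) k2(1) k(3,4)] by (simp add: grace_def)
      then show "1 + (b k - u) + dist (trajectory Queen (1 + (b k - u))) x \<le> 2 + kappa * e + e"
        unfolding Q xu using e_pos step_pos by (intro queen_arrival) auto
    qed (use k m in \<open>auto simp: robots_def image_iff\<close>)
  qed
qed

end

theorem theorem1:
  fixes n :: nat
  assumes "n \<ge> 4"
  shows "\<exists>A. solves_PE n A \<and> evacuation_time n A \<le> ereal (2 + 4 * (sqrt 2 - 1) * (pi / real n))"
proof -
  define e where "e = 2 * sweep pi / (real n * kappa)"
  have k: "kappa > 0" using kappa_bounds by simp
  have total: "real n * (kappa * e) = 2 * sweep pi" using assms k by (simp add: e_def)
  have "\<exists>s. (0 \<le> s \<and> s \<le> 2 * pi) \<and> sweep s = real j * (kappa * e)" if "j \<le> n" for j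
  proof -
    have sp: "0 \<le> sweep pi" by (rule sweep_nonneg) simp
    then have ke: "0 \<le> kappa * e" using k by (simp add: e_def)
    then have "real j * (kappa * e) \<le> 2 * sweep pi"
      unfolding total[symmetric] using that by (intro mult_right_mono) auto
    with ke show ?thesis by (metis sweep_surj mult_nonneg_nonneg of_nat_0_le_iff)
  qed
  then obtain b where b: "\<And>j. j \<le> n \<Longrightarrow> (0 \<le> b j \<and> b j \<le> 2 * pi) \<and> sweep (b j) = real j * (kappa * e)"
    by metis
  interpret partition n e b by unfold_locales (use assms total b in auto)
  have "kappa * e + e = 4 * (sqrt 2 - 1) * (pi / real n)"
  proof -
    \<comment> \<open>Both sides equal \<open>2\<close>.\<close>
    have "(kappa + 1) * (3 - kappa) = 2 * (sqrt 2 - 1) * kappa"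
      by (simp add: kappa_def algebra_simps)
    moreover have "(kappa + 1) * e = 2 * pi * ((kappa + 1) * (3 - kappa)) / (real n * kappa)"
      by (simp add: e_def sweep_pi)
    ultimately have "(kappa + 1) * e = 2 * pi * (2 * (sqrt 2 - 1)) / real n"
      using k by simp
    then show ?thesis by (simp add: algebra_simps diff_divide_distrib)
  qed
  then show ?thesis
    using solves_PE_evacuation_time_le[OF valid_trajectory trajectory_visits]
    by (intro exI[of _ trajectory]) (simp add: add.assoc)
qed

end
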